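(* Let $P\colon\mathcal E\to\mathcal B$ be a Grothendieck fibration, $K$ a covering function on $\mathcal B$ satisfying axiom $(\tilde{\mathrm M})$, and $\mathrm{Triv}\subset P$ a subfunctor of trivial objects, with base category $\mathrm{Triv}_b\subset\mathcal B$ and total category $\mathrm{Triv}_t\subset\mathcal E$. Suppose $\mathrm{Triv}\subset P$ is a replete, globally full, strong subfibration of $P$. Suppose $K_l$ is a coverage. Then the subfunctor of locally trivial objects $\mathrm{Loc}\subset P$ is a replete, globally full, strong subfibration of $P$.
   Context: A covering of an object $C$ is a class of arrows with codomain $C$; a covering function $K$ on $\mathcal B$ assigns to each object a collection of coverings of it. $R$ refines $S$ (coverings of the same object) if each arrow of $R$ factors through an arrow of $S$. Axiom $(\tilde{\mathrm M})$: for each isomorphism $f\colon D\to C$, $\{f\}\in K(C)$. A covering function $K$ is a coverage if it satisfies axiom (C): for each object $C$, each $K$-covering $R$ of $C$ and each arrow $g\colon D\to C$ of the category on which $K$ is defined, there is a $K$-covering $S$ of $D$ such that $g\circ S=\{g\circ h\mid h\in S\}$ refines $R$. A subfunctor of $P$ is a functor $\bar P\colon\mathcal D\to\mathcal A$ with $\mathcal D\subset\mathcal E$ and $\mathcal A\subset\mathcal B$ subcategories and $\bar P$ the restriction of $P$. It is replete if each fibre inclusion $\mathcal D_A\subset\mathcal E_A$ ($A\in\mathcal A$) is replete: for each vertical isomorphism (isomorphism over an identity) $D\cong E$ of $\mathcal E_A$ with $D\in\mathcal D_A$, both $E$ and the isomorphism are in $\mathcal D_A$. It is globally full if both $\mathcal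 D\subset\mathcal E$ and $\mathcal A\subset\mathcal B$ are full. It is a subfibration if $\bar P$ is a fibration, and a strong subfibration if moreover the inclusion $\mathcal D\hookrightarrow\mathcal E$ sends $\bar P$-Cartesian arrows to $P$-Cartesian arrows. A subfunctor of trivial objects is a replete subfunctor $\mathrm{Triv}$ of $P$; its restriction of $P$ is $\mathrm{Triv}_t\to\mathrm{Triv}_b$; objects of $\mathrm{Triv}_t$ and $\mathrm{Triv}_b$ are called trivial. An object $B\in\mathcal B$ is locally trivial if it has a $K$-covering whose arrows all have domains in $\mathrm{Triv}_b$. An object $E\in\mathcal E$ is locally trivial if there is a $K$-covering $R$ of $P(E)$ such that for each $f\in R$ there is a $P$-Cartesian arrow $T_f\to E$ over $f$ with $T_f\in\mathrm{Triv}_t$. $\mathrm{Loc}_b\subset\mathcal B$ and $\mathrm{Loc}_t\subset\mathcal E$ are the full subcategories of locally trivial objects and $\mathrm{Loc}\colon\mathrm{Loc}_t\to\mathrm{Loc}_b$ is the restriction of $P$. $K_l$ is the covering function on the category $\mathrm{Loc}_b$ whose coverings are the $K$-coverings all of whose arrows have domain in $\mathrm{Triv}_b$. *)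

theory Defs
  imports Main
begin

section \<open>Categories\<close>

record ('o, 'a) cat =
  Obj :: "'o set"
  Arr :: "'a set"
  Dom :: "'a \<Rightarrow> 'o"
  Cod :: "'a \<Rightarrow> 'o"
  Id :: "'o \<Rightarrow> 'a"
  Comp :: "'a \<Rightarrow> 'a \<Rightarrow> 'a"  (infixl "\<cdot>\<index>" 70)

text \<open>Composition is in function order: \<open>g \<cdot>\<^bsub>C\<^esub> f\<close> is ``first \<open>f\<close>, then \<open>g\<close>'' and is only
  meaningful when \<open>Cod C f = Dom C g\<close>.\<close>

definition Hom :: "('o, 'a) cat \<Rightarrow> 'o \<Rightarrow> 'o \<Rightarrow> 'a set" where
  "Hom C X Y = {f \<in> Arr C. Dom C f = X \<and> Cod C f = Y}"

locale category =
  fixes C :: "('o, 'a) cat"  (structure)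
  assumes dom_in: "f \<in> Arr C \<Longrightarrow> Dom C f \<in> Obj C"
    and cod_in: "f \<in> Arr C \<Longrightarrow> Cod C f \<in> Obj C"
    and id_in: "X \<in> Obj C \<Longrightarrow> Id C X \<in> Hom C X X"
    and comp_in: "f \<in> Hom C X Y \<Longrightarrow> g \<in> Hom C Y Z \<Longrightarrow> g \<cdot> f \<in> Hom C X Z"
    and id_right: "f \<in> Hom C X Y \<Longrightarrow> f \<cdot> Id C X = f"
    and id_left: "f \<in> Hom C X Y \<Longrightarrow> Id C Y \<cdot> f = f"
    and assoc: "f \<in> Hom C W X \<Longrightarrow> g \<in> Hom C X Y \<Longrightarrow> h \<in> Hom C Y Z
      \<Longrightarrow> (h \<cdot> g) \<cdot> f = h \<cdot> (g \<cdot> f)"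

definition is_iso :: "('o, 'a) cat \<Rightarrow> 'a \<Rightarrow> bool" where
  "is_iso C f \<longleftrightarrow> f \<in> Arr C \<and>
     (\<exists>g \<in> Hom C (Cod C f) (Dom C f).
        g \<cdot>\<^bsub>C\<^esub> f = Id C (Dom C f) \<and> f \<cdot>\<^bsub>C\<^esub> g = Id C (Cod C f))"

definition subcategory :: "('o, 'a) cat \<Rightarrow> ('o, 'a) cat \<Rightarrow> bool" where
  "subcategory D C \<longleftrightarrow> category D \<and> category C \<and> Obj D \<subseteq> Obj C \<and> Arr D \<subseteq> Arr C \<and>
     (\<forall>f \<in> Arr D. Dom D f = Dom C f \<and> Cod D f = Cod C f) \<and>
     (\<forall>X \<in> Obj D. Id D X = Id C X) \<and>
     (\<forall>f \<in> Arr D. \<forall>g \<in> Arr D. Cod D f = Dom D g \<longrightarrow> g \<cdot>\<^bsub>D\<^esub> f = g \<cdot>\<^bsub>C\<^esub> f)"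

definition full_subcategory :: "('o, 'a) cat \<Rightarrow> ('o, 'a) cat \<Rightarrow> bool" where
  "full_subcategory D C \<longleftrightarrow> subcategory D C \<and>
     (\<forall>f \<in> Arr C. Dom C f \<in> Obj D \<and> Cod C f \<in> Obj D \<longrightarrow> f \<in> Arr D)"

text \<open>The full subcategory of \<open>C\<close> on a set of objects of \<open>C\<close>.\<close>

definition full_on :: "('o, 'a) cat \<Rightarrow> 'o set \<Rightarrow> ('o, 'a) cat" where
  "full_on C S = C\<lparr>Obj := S, Arr := {f \<in> Arr C. Dom C f \<in> S \<and> Cod C f \<in> S}\<rparr>"

definition replete_inclusion :: "('o, 'a) cat \<Rightarrow> ('o, 'a) cat \<Rightarrow> bool" where
  "replete_inclusion D C \<longleftrightarrow>
     (\<forall>f. is_iso C f \<and> Dom C f \<in> Obj D \<longrightarrow> Cod C f \<in> Obj D \<and> f \<in> Arr D)"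


section \<open>Functors and fibrations\<close>

record ('o, 'a, 'p, 'b) fun_data =
  omap :: "'o \<Rightarrow> 'p"
  amap :: "'a \<Rightarrow> 'b"

text \<open>Functoriality only concerns the values of \<open>P\<close> on \<open>E\<close>, so the restriction of a functor \<open>P\<close>
  to a subcategory is represented by \<open>P\<close> itself.\<close>

locale cat_functor = E: category E + B: category B
  for E :: "('o, 'a) cat" and B :: "('p, 'b) cat" +
  fixes P :: "('o, 'a, 'p, 'b) fun_data"
  assumes omap_in: "X \<in> Obj E \<Longrightarrow> omap P X \<in> Obj B"
    and amap_in: "f \<in> Hom E X Y \<Longrightarrow> amap P f \<in> Hom B (omap P X) (omap P Y)"
    and amap_id: "X \<in> Obj E \<Longrightarrow> amap P (Id E X) = Id B (omap P X)"
    and amap_comp: "f \<in> Hom E X Y \<Longrightarrow> g \<in> Hom E Y Z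
      \<Longrightarrow> amap P (g \<cdot>\<^bsub>E\<^esub> f) = amap P g \<cdot>\<^bsub>B\<^esub> amap P f"

definition fibre ::
    "('o, 'a) cat \<Rightarrow> ('p, 'b) cat \<Rightarrow> ('o, 'a, 'p, 'b) fun_data \<Rightarrow> 'p \<Rightarrow> ('o, 'a) cat" where
  "fibre E B P A = E\<lparr>Obj := {X \<in> Obj E. omap P X = A}, Arr := {f \<in> Arr E. amap P f = Id B A}\<rparr>"

definition cartesian ::
    "('o, 'a) cat \<Rightarrow> ('p, 'b) cat \<Rightarrow> ('o, 'a, 'p, 'b) fun_data \<Rightarrow> 'a \<Rightarrow> bool" where
  "cartesian E B P g \<longleftrightarrow> g \<in> Arr E \<and>
     (\<forall>h \<in> Arr E. \<forall>u \<in> Hom B (omap P (Dom E h)) (omap P (Dom E g)).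
        Cod E h = Cod E g \<and> amap P h = amap P g \<cdot>\<^bsub>B\<^esub> u \<longrightarrow>
        (\<exists>!k. k \<in> Hom E (Dom E h) (Dom E g) \<and> amap P k = u \<and> g \<cdot>\<^bsub>E\<^esub> k = h))"

definition fibration ::
    "('o, 'a) cat \<Rightarrow> ('p, 'b) cat \<Rightarrow> ('o, 'a, 'p, 'b) fun_data \<Rightarrow> bool" where
  "fibration E B P \<longleftrightarrow> cat_functor E B P \<and>
     (\<forall>X \<in> Obj E. \<forall>f \<in> Arr B. Cod B f = omap P X \<longrightarrow>
        (\<exists>g. cartesian E B P g \<and> Cod E g = X \<and> amap P g = f))"


section \<open>Subfunctors\<close>

text \<open>In the following predicates \<open>D \<rightarrow> A\<close> is the restriction of \<open>P : E \<rightarrow> B\<close>.\<close>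

definition subfunctor :: "('o, 'a) cat \<Rightarrow> ('p, 'b) cat \<Rightarrow>
    ('o, 'a) cat \<Rightarrow> ('p, 'b) cat \<Rightarrow> ('o, 'a, 'p, 'b) fun_data \<Rightarrow> bool" where
  "subfunctor D A E B P \<longleftrightarrow>
     subcategory D E \<and> subcategory A B \<and> cat_functor E B P \<and> cat_functor D A P"

definition replete_subfunctor :: "('o, 'a) cat \<Rightarrow> ('p, 'b) cat \<Rightarrow>
    ('o, 'a) cat \<Rightarrow> ('p, 'b) cat \<Rightarrow> ('o, 'a, 'p, 'b) fun_data \<Rightarrow> bool" where
  "replete_subfunctor D A E B P \<longleftrightarrow> subfunctor D A E B P \<and>
     (\<forall>X \<in> Obj A. replete_inclusion (fibre D A P X) (fibre E B P X))"

definition globally_full :: "('o, 'a) cat \<Rightarrow> ('p, 'b) cat \<Rightarrow>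
    ('o, 'a) cat \<Rightarrow> ('p, 'b) cat \<Rightarrow> ('o, 'a, 'p, 'b) fun_data \<Rightarrow> bool" where
  "globally_full D A E B P \<longleftrightarrow>
     subfunctor D A E B P \<and> full_subcategory D E \<and> full_subcategory A B"

definition subfibration :: "('o, 'a) cat \<Rightarrow> ('p, 'b) cat \<Rightarrow>
    ('o, 'a) cat \<Rightarrow> ('p, 'b) cat \<Rightarrow> ('o, 'a, 'p, 'b) fun_data \<Rightarrow> bool" where
  "subfibration D A E B P \<longleftrightarrow> subfunctor D A E B P \<and> fibration D A P"

definition strong_subfibration :: "('o, 'a) cat \<Rightarrow> ('p, 'b) cat \<Rightarrow>
    ('o, 'a) cat \<Rightarrow> ('p, 'b) cat \<Rightarrow> ('o, 'a, 'p, 'b) fun_data \<Rightarrow> bool" where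
  "strong_subfibration D A E B P \<longleftrightarrow> subfibration D A E B P \<and>
     (\<forall>g. cartesian D A P g \<longrightarrow> cartesian E B P g)"


section \<open>Covering functions\<close>

definition covering_function :: "('o, 'a) cat \<Rightarrow> ('o \<Rightarrow> 'a set set) \<Rightarrow> bool" where
  "covering_function C K \<longleftrightarrow>
     (\<forall>X \<in> Obj C. \<forall>R \<in> K X. \<forall>f \<in> R. f \<in> Arr C \<and> Cod C f = X)"

definition refines :: "('o, 'a) cat \<Rightarrow> 'a set \<Rightarrow> 'a set \<Rightarrow> bool" where
  "refines C R S \<longleftrightarrow>
     (\<forall>f \<in> R. \<exists>g \<in> S. \<exists>h \<in> Hom C (Dom C f) (Dom C g). f = g \<cdot>\<^bsub>C\<^esub> h)"

definition coverage :: "('o, 'a) cat \<Rightarrow> ('o \<Rightarrow> 'a set set) \<Rightarrow> bool" where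
  "coverage C K \<longleftrightarrow> covering_function C K \<and>
     (\<forall>X \<in> Obj C. \<forall>R \<in> K X. \<forall>g \<in> Arr C. Cod C g = X \<longrightarrow>
        (\<exists>S \<in> K (Dom C g). refines C ((\<lambda>h. g \<cdot>\<^bsub>C\<^esub> h) ` S) R))"

definition isos_cover :: "('o, 'a) cat \<Rightarrow> ('o \<Rightarrow> 'a set set) \<Rightarrow> bool" where
  "isos_cover C K \<longleftrightarrow> (\<forall>f. is_iso C f \<longrightarrow> {f} \<in> K (Cod C f))"


section \<open>Locally trivial objects\<close>

definition loc_b :: "('p, 'b) cat \<Rightarrow> ('p \<Rightarrow> 'b set set) \<Rightarrow> ('p, 'b) cat \<Rightarrow> ('p, 'b) cat" where
  "loc_b B K Trivb =
     full_on B {X \<in> Obj B. \<exists>R \<in> K X. \<forall>f \<in> R. Dom B f \<in> Obj Trivb}"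

definition loc_t :: "('o, 'a) cat \<Rightarrow> ('p, 'b) cat \<Rightarrow> ('o, 'a, 'p, 'b) fun_data \<Rightarrow>
    ('p \<Rightarrow> 'b set set) \<Rightarrow> ('o, 'a) cat \<Rightarrow> ('o, 'a) cat" where
  "loc_t E B P K Trivt =
     full_on E {X \<in> Obj E. \<exists>R \<in> K (omap P X). \<forall>f \<in> R.
       \<exists>t. cartesian E B P t \<and> Cod E t = X \<and> amap P t = f \<and> Dom E t \<in> Obj Trivt}"

text \<open>To be read as a covering function on \<open>loc_b B K Trivb\<close>.\<close>

definition K_loc ::
    "('p, 'b) cat \<Rightarrow> ('p \<Rightarrow> 'b set set) \<Rightarrow> ('p, 'b) cat \<Rightarrow> 'p \<Rightarrow> 'b set set" where
  "K_loc B K Trivb X = {R \<in> K X. \<forall>f \<in> R. Dom B f \<in> Obj Trivb}"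

end

theory Submission
  imports Defs
begin

text \<open>
  Local triviality of an object \<open>X\<close> over \<open>C\<close> is witnessed by a covering \<open>R\<close> of \<open>C\<close> together with
  Cartesian arrows into \<open>X\<close>, one over each \<open>f \<in> R\<close>, with trivial domains. Everything rests on the
  calculus of Cartesian arrows: they compose (\<open>cartesian_comp\<close>), they cancel on the left
  (\<open>cartesian_cancel\<close>), and isomorphisms are Cartesian (\<open>iso_cartesian\<close>).

  Repleteness holds because the witnesses can be composed with a vertical isomorphism
  \<open>X \<cong> Y\<close>: they stay Cartesian and still lie over the same covering. Global fullness is built into
  the definition of \<open>Loc\<close>.

  The content is that a Cartesian arrow \<open>t : Y \<rightarrow> X\<close> over an arrow \<open>g : D \<rightarrow> C\<close> of locally trivial
  objects has a locally trivial domain (\<open>cartesian_lift_locally_trivial\<close>). Since \<open>K\<^sub>l\<close> is a coverage,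
  some covering \<open>S\<close> of \<open>D\<close> by trivial objects has \<open>g \<circ> S\<close> refining the covering \<open>R\<close> that trivializes
  \<open>X\<close>. So for \<open>s \<in> S\<close> there are \<open>f \<in> R\<close> and \<open>k\<close> with \<open>g \<circ> s = f \<circ> k\<close>, and \<open>k\<close>, being an arrow
  between trivial objects, lies in \<open>Triv\<^sub>b\<close> by fullness. In the fibration \<open>Triv\<close> the arrow \<open>k\<close> lifts to a
  Cartesian \<open>k'\<close> ending at the trivial domain of the witness \<open>r\<close> over \<open>f\<close>; by strength \<open>k'\<close> is
  \<open>P\<close>-Cartesian. Factoring the Cartesian \<open>r \<circ> k'\<close> over \<open>g \<circ> s\<close> through \<open>t\<close> gives an arrow into \<open>Y\<close>
  over \<open>s\<close>, Cartesian by cancellation, with trivial domain.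

  Hence Cartesian lifts taken in \<open>E\<close> stay inside the full subcategory \<open>Loc\<^sub>t\<close>. That alone makes a
  full restriction of \<open>P\<close> a strong subfibration (\<open>strong_subfibration_full_on\<close>): these lifts are
  Cartesian for the restriction, and any other Cartesian arrow of the restriction differs from one of
  them by an isomorphism.
\<close>

section \<open>Cartesian arrows\<close>

lemma cartesian_factor:
  assumes "cartesian E B P g" and "g \<in> Hom E Y X" and "h \<in> Hom E Z X"
    and "u \<in> Hom B (omap P Z) (omap P Y)" and "amap P h = amap P g \<cdot>\<^bsub>B\<^esub> u"
  shows "\<exists>!k. k \<in> Hom E Z Y \<and> amap P k = u \<and> g \<cdot>\<^bsub>E\<^esub> k = h"
proof -
  have eqs: "Y = Dom E g" "X = Cod E g" "Z = Dom E h" and h: "h \<in> Arr E" "Cod E h = Cod E g"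
    using assms(2,3) by (auto simp: Hom_def)
  show ?thesis using assms(1,4,5) h unfolding cartesian_def eqs by blast
qed

lemma cartesianI:
  assumes "g \<in> Hom E Y X"
    and "\<And>Z h u. h \<in> Hom E Z X \<Longrightarrow> u \<in> Hom B (omap P Z) (omap P Y)
      \<Longrightarrow> amap P h = amap P g \<cdot>\<^bsub>B\<^esub> u
      \<Longrightarrow> \<exists>!k. k \<in> Hom E Z Y \<and> amap P k = u \<and> g \<cdot>\<^bsub>E\<^esub> k = h"
  shows "cartesian E B P g"
  using assms unfolding cartesian_def Hom_def by simp

context cat_functor
begin

lemma cartesian_unique:
  assumes g: "cartesian E B P g" "g \<in> Hom E Y X"
    and k: "k \<in> Hom E Z Y" and k': "k' \<in> Hom E Z Y"
    and eq: "amap P k = amap P k'" "g \<cdot>\<^bsub>E\<^esub> k = g \<cdot>\<^bsub>E\<^esub> k'"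
  shows "k = k'"
  using cartesian_factor[OF g E.comp_in[OF k g(2)] amap_in[OF k] amap_comp[OF k g(2)]] k k' eq
  by metis

lemma cartesian_comp:
  assumes f: "cartesian E B P f" "f \<in> Hom E Z Y"
    and g: "cartesian E B P g" "g \<in> Hom E Y X"
  shows "cartesian E B P (g \<cdot>\<^bsub>E\<^esub> f)"
proof (rule cartesianI)
  show "g \<cdot>\<^bsub>E\<^esub> f \<in> Hom E Z X" using f g by (blast intro: E.comp_in)
  fix W h u
  assume h: "h \<in> Hom E W X" and u: "u \<in> Hom B (omap P W) (omap P Z)"
    and eq: "amap P h = amap P (g \<cdot>\<^bsub>E\<^esub> f) \<cdot>\<^bsub>B\<^esub> u"
  have Pf: "amap P f \<in> Hom B (omap P Z) (omap P Y)"
    and Pg: "amap P g \<in> Hom B (omap P Y) (omap P X)"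
    using f g by (auto intro: amap_in)
  have fu: "amap P f \<cdot>\<^bsub>B\<^esub> u \<in> Hom B (omap P W) (omap P Y)"
    using u Pf by (rule B.comp_in)
  have "amap P h = amap P g \<cdot>\<^bsub>B\<^esub> (amap P f \<cdot>\<^bsub>B\<^esub> u)"
    using eq f g u Pf Pg by (simp add: amap_comp B.assoc)
  from cartesian_factor[OF g h fu this] obtain l where
    l: "l \<in> Hom E W Y" "amap P l = amap P f \<cdot>\<^bsub>B\<^esub> u" "g \<cdot>\<^bsub>E\<^esub> l = h"
    and l_unique: "\<And>l'. l' \<in> Hom E W Y \<Longrightarrow> amap P l' = amap P f \<cdot>\<^bsub>B\<^esub> u \<Longrightarrow> g \<cdot>\<^bsub>E\<^esub> l' = h
      \<Longrightarrow> l' = l" by blast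
  from cartesian_factor[OF f l(1) u l(2)]
  obtain k where k: "k \<in> Hom E W Z" "amap P k = u" "f \<cdot>\<^bsub>E\<^esub> k = l"
    and k_unique: "\<And>k'. k' \<in> Hom E W Z \<Longrightarrow> amap P k' = u \<Longrightarrow> f \<cdot>\<^bsub>E\<^esub> k' = l \<Longrightarrow> k' = k" by blast
  show "\<exists>!k. k \<in> Hom E W Z \<and> amap P k = u \<and> (g \<cdot>\<^bsub>E\<^esub> f) \<cdot>\<^bsub>E\<^esub> k = h"
  proof (rule ex1I[of _ k])
    show "k \<in> Hom E W Z \<and> amap P k = u \<and> (g \<cdot>\<^bsub>E\<^esub> f) \<cdot>\<^bsub>E\<^esub> k = h"
      using k l f g E.assoc[of k W Z f Y g X] by simp
    fix k' assume k': "k' \<in> Hom E W Z \<and> amap P k' = u \<and> (g \<cdot>\<^bsub>E\<^esub> f) \<cdot>\<^bsub>E\<^esub> k' = h"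
    then have "f \<cdot>\<^bsub>E\<^esub> k' = l"
      using f g by (intro l_unique) (auto simp: amap_comp E.assoc intro: E.comp_in)
    with k' show "k' = k" using k_unique by blast
  qed
qed

lemma cartesian_cancel:
  assumes f: "f \<in> Hom E Z Y"
    and g: "cartesian E B P g" "g \<in> Hom E Y X"
    and gf: "cartesian E B P (g \<cdot>\<^bsub>E\<^esub> f)"
  shows "cartesian E B P f"
proof (rule cartesianI[OF f])
  fix W h u
  assume h: "h \<in> Hom E W Y" and u: "u \<in> Hom B (omap P W) (omap P Z)"
    and eq: "amap P h = amap P f \<cdot>\<^bsub>B\<^esub> u"
  have Pf: "amap P f \<in> Hom B (omap P Z) (omap P Y)"
    and Pg: "amap P g \<in> Hom B (omap P Y) (omap P X)"
    using f g by (auto intro: amap_in)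
  have gfZ: "g \<cdot>\<^bsub>E\<^esub> f \<in> Hom E Z X" and gh: "g \<cdot>\<^bsub>E\<^esub> h \<in> Hom E W X"
    using f g h by (auto intro: E.comp_in)
  have eq': "amap P (g \<cdot>\<^bsub>E\<^esub> h) = amap P (g \<cdot>\<^bsub>E\<^esub> f) \<cdot>\<^bsub>B\<^esub> u"
    using f g h u Pf Pg eq by (simp add: amap_comp B.assoc)
  from cartesian_factor[OF gf gfZ gh u eq']
  obtain k where k: "k \<in> Hom E W Z" "amap P k = u" "(g \<cdot>\<^bsub>E\<^esub> f) \<cdot>\<^bsub>E\<^esub> k = g \<cdot>\<^bsub>E\<^esub> h"
    and k_unique: "\<And>k'. k' \<in> Hom E W Z \<Longrightarrow> amap P k' = u
      \<Longrightarrow> (g \<cdot>\<^bsub>E\<^esub> f) \<cdot>\<^bsub>E\<^esub> k' = g \<cdot>\<^bsub>E\<^esub> h \<Longrightarrow> k' = k" by blast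
  have fk: "f \<cdot>\<^bsub>E\<^esub> k = h"
    using g E.comp_in[OF k(1) f] h
  proof (rule cartesian_unique)
    show "amap P (f \<cdot>\<^bsub>E\<^esub> k) = amap P h" by (simp add: amap_comp[OF k(1) f] k(2) eq)
    show "g \<cdot>\<^bsub>E\<^esub> (f \<cdot>\<^bsub>E\<^esub> k) = g \<cdot>\<^bsub>E\<^esub> h" using k E.assoc[OF k(1) f g(2)] by simp
  qed
  have unique: "k' = k" if "k' \<in> Hom E W Z" "amap P k' = u" "f \<cdot>\<^bsub>E\<^esub> k' = h" for k'
    using that f g by (intro k_unique) (simp_all add: E.assoc)
  show "\<exists>!k. k \<in> Hom E W Z \<and> amap P k = u \<and> f \<cdot>\<^bsub>E\<^esub> k = h"
    by (rule ex1I[of _ k]) (simp add: k fk, elim conjE, rule unique)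
qed

lemma iso_cartesian:
  assumes v: "v \<in> Hom E Y X" and w: "w \<in> Hom E X Y"
    and wv: "w \<cdot>\<^bsub>E\<^esub> v = Id E Y" and vw: "v \<cdot>\<^bsub>E\<^esub> w = Id E X"
  shows "cartesian E B P v"
proof (rule cartesianI[OF v])
  fix Z h u
  assume h: "h \<in> Hom E Z X" and u: "u \<in> Hom B (omap P Z) (omap P Y)"
    and eq: "amap P h = amap P v \<cdot>\<^bsub>B\<^esub> u"
  have Y: "Y \<in> Obj E" using v E.dom_in by (auto simp: Hom_def)
  have Pv: "amap P v \<in> Hom B (omap P Y) (omap P X)"
    and Pw: "amap P w \<in> Hom B (omap P X) (omap P Y)"
    using v w by (auto intro: amap_in)
  have "amap P (w \<cdot>\<^bsub>E\<^esub> h) = (amap P w \<cdot>\<^bsub>B\<^esub> amap P v) \<cdot>\<^bsub>B\<^esub> u"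
    using h w eq B.assoc[OF u Pv Pw] by (simp add: amap_comp)
  also have "\<dots> = amap P (w \<cdot>\<^bsub>E\<^esub> v) \<cdot>\<^bsub>B\<^esub> u" using v w by (simp add: amap_comp)
  also have "\<dots> = u" using Y u by (simp add: wv amap_id B.id_left)
  finally have Pwh: "amap P (w \<cdot>\<^bsub>E\<^esub> h) = u" .
  have vwh: "v \<cdot>\<^bsub>E\<^esub> (w \<cdot>\<^bsub>E\<^esub> h) = h"
    using E.assoc[OF h w v] h by (simp add: vw E.id_left)
  have unique: "k = w \<cdot>\<^bsub>E\<^esub> h" if "k \<in> Hom E Z Y" "v \<cdot>\<^bsub>E\<^esub> k = h" for k
    using E.assoc[OF that(1) v w] that by (simp add: wv E.id_left)
  show "\<exists>!k. k \<in> Hom E Z Y \<and> amap P k = u \<and> v \<cdot>\<^bsub>E\<^esub> k = h"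
    by (rule ex1I[of _ "w \<cdot>\<^bsub>E\<^esub> h"]) (simp add: E.comp_in[OF h w] Pwh vwh, elim conjE, rule unique)
qed

end


section \<open>Full restrictions of a functor\<close>

lemma full_on_simps [simp]:
  "Obj (full_on C S) = S"
  "Arr (full_on C S) = {f \<in> Arr C. Dom C f \<in> S \<and> Cod C f \<in> S}"
  "Dom (full_on C S) = Dom C" "Cod (full_on C S) = Cod C"
  "Id (full_on C S) = Id C" "Comp (full_on C S) = Comp C"
  by (simp_all add: full_on_def)

lemma Hom_full_on:
  "f \<in> Hom (full_on C S) X Y \<longleftrightarrow> f \<in> Hom C X Y \<and> X \<in> S \<and> Y \<in> S"
  by (auto simp: Hom_def)

lemma full_subcategory_full_on:
  assumes "category C" and "S \<subseteq> Obj C"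
  shows "full_subcategory (full_on C S) C"
proof -
  interpret category C by fact
  have "category (full_on C S)"
    using assms(2)
    by unfold_locales (auto simp: Hom_full_on intro: id_in comp_in id_right id_left assoc)
  with assms show ?thesis by (auto simp: full_subcategory_def subcategory_def)
qed

lemma subfunctor_full_on:
  assumes "cat_functor E B P" and "S \<subseteq> Obj E" and "T \<subseteq> Obj B" and "omap P ` S \<subseteq> T"
  shows "subfunctor (full_on E S) (full_on B T) E B P"
proof -
  interpret cat_functor E B P by fact
  have sub: "subcategory (full_on E S) E" "subcategory (full_on B T) B"
    using full_subcategory_full_on[OF E.category_axioms assms(2)]
      full_subcategory_full_on[OF B.category_axioms assms(3)]
    by (simp_all add: full_subcategory_def)
  then interpret D: category "full_on E S" + A: category "full_on B T"
    by (simp_all add: subcategory_def)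
  have "cat_functor (full_on E S) (full_on B T) P"
    using assms(2-4)
    by unfold_locales (auto simp: Hom_full_on intro: amap_in amap_id amap_comp)
  with sub assms(1) show ?thesis by (simp add: subfunctor_def)
qed

lemma cartesian_full_on:
  assumes "cartesian E B P g" and "g \<in> Hom E Y X" and "X \<in> S" and "Y \<in> S"
  shows "cartesian (full_on E S) (full_on B T) P g"
proof (rule cartesianI)
  show "g \<in> Hom (full_on E S) Y X" using assms by (simp add: Hom_full_on)
qed (use cartesian_factor[OF assms(1,2)] in \<open>auto simp: Hom_full_on assms\<close>)

text \<open>
  Strength comes for free here. Given \<open>g\<close> Cartesian for the restriction, the lift \<open>t\<close> of \<open>P g\<close>
  provided by the hypothesis is Cartesian both for the restriction and for \<open>P\<close>, so \<open>g\<close> and \<open>t\<close>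
  factor through each other by mutually inverse vertical arrows, and \<open>g\<close> inherits the property
  from \<open>t\<close>.
\<close>

lemma strong_subfibration_full_on:
  assumes "cat_functor E B P" and S: "S \<subseteq> Obj E" and T: "T \<subseteq> Obj B" and PS: "omap P ` S \<subseteq> T"
    and lift: "\<And>X f. X \<in> S \<Longrightarrow> f \<in> Arr B \<Longrightarrow> Dom B f \<in> T \<Longrightarrow> Cod B f = omap P X
      \<Longrightarrow> \<exists>t. cartesian E B P t \<and> Cod E t = X \<and> amap P t = f \<and> Dom E t \<in> S"
  shows "strong_subfibration (full_on E S) (full_on B T) E B P"
    (is "strong_subfibration ?D ?A E B P")
proof -
  interpret cat_functor E B P by fact
  have sub: "subfunctor ?D ?A E B P" using assms(1) S T PS by (rule subfunctor_full_on)
  interpret D: cat_functor ?D ?A P using sub by (simp add: subfunctor_def)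
  have "fibration ?D ?A P"
    unfolding fibration_def
  proof (intro conjI ballI impI)
    show "cat_functor ?D ?A P" by (rule D.cat_functor_axioms)
    fix X f assume X: "X \<in> Obj ?D" and f: "f \<in> Arr ?A" "Cod ?A f = omap P X"
    then obtain t where t: "cartesian E B P t" "Cod E t = X" "amap P t = f" "Dom E t \<in> S"
      using lift[of X f] by auto
    then have "t \<in> Hom E (Dom E t) X" by (simp add: cartesian_def Hom_def)
    with t X show "\<exists>t. cartesian ?D ?A P t \<and> Cod ?D t = X \<and> amap P t = f"
      using cartesian_full_on[of E B P t] by fastforce
  qed
  moreover have "cartesian E B P g" if g: "cartesian ?D ?A P g" for g
  proof -
    define X Y where "X = Cod E g" and "Y = Dom E g"
    have gS: "g \<in> Hom E Y X" "X \<in> S" "Y \<in> S"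
      using g by (auto simp: cartesian_def X_def Y_def Hom_def)
    have Pg: "amap P g \<in> Hom B (omap P Y) (omap P X)" using gS(1) by (rule amap_in)
    then obtain t where t: "cartesian E B P t" "Cod E t = X" "amap P t = amap P g" "Dom E t \<in> S"
      using lift[of X "amap P g"] gS PS by (auto simp: Hom_def)
    define Z where "Z = Dom E t"
    have tS: "t \<in> Hom E Z X" "Z \<in> S" using t by (auto simp: cartesian_def Hom_def Z_def)
    have ZY: "omap P Z = omap P Y" using amap_in[OF tS(1)] Pg t(3) by (simp add: Hom_def)
    have Y: "Y \<in> Obj E" and Z: "Z \<in> Obj E" and PY: "omap P Y \<in> Obj B"
      using S gS tS omap_in by auto
    let ?i = "Id B (omap P Y)"
    have i: "?i \<in> Hom B (omap P Y) (omap P Y)" and gi: "amap P g \<cdot>\<^bsub>B\<^esub> ?i = amap P g"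
      and ii: "?i \<cdot>\<^bsub>B\<^esub> ?i = ?i"
      using B.id_in[OF PY] B.id_right Pg by auto
    have gD: "g \<in> Hom ?D Y X" "t \<in> Hom ?D Z X" using gS tS by (simp_all add: Hom_full_on)
    have iD: "?i \<in> Hom ?A (omap P Y) (omap P Y)" using i gS PS by (auto simp: Hom_full_on)
    \<comment> \<open>\<open>a\<close> and \<open>b\<close> compare \<open>g\<close> and \<open>t\<close>; both composites are endomorphisms over an identity that
      \<open>g\<close>, respectively \<open>t\<close>, does not distinguish from the identity.\<close>
    obtain a where a: "a \<in> Hom E Z Y" "amap P a = ?i" "g \<cdot>\<^bsub>E\<^esub> a = t"
      using cartesian_factor[OF g gD(1,2), of ?i] iD ZY t(3) gi by (auto simp: Hom_full_on)
    obtain b where b: "b \<in> Hom E Y Z" "amap P b = ?i" "t \<cdot>\<^bsub>E\<^esub> b = g"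
      using cartesian_factor[OF t(1) tS(1) gS(1), of ?i] i ZY t(3) gi by auto
    have ab: "a \<cdot>\<^bsub>E\<^esub> b \<in> Hom E Y Y" "amap P (a \<cdot>\<^bsub>E\<^esub> b) = ?i" "g \<cdot>\<^bsub>E\<^esub> (a \<cdot>\<^bsub>E\<^esub> b) = g"
      using a b ii E.assoc[OF b(1) a(1) gS(1)] by (auto intro: E.comp_in simp: amap_comp)
    have ba: "b \<cdot>\<^bsub>E\<^esub> a \<in> Hom E Z Z" "amap P (b \<cdot>\<^bsub>E\<^esub> a) = ?i" "t \<cdot>\<^bsub>E\<^esub> (b \<cdot>\<^bsub>E\<^esub> a) = t"
      using a b ii E.assoc[OF a(1) b(1) tS(1)] by (auto intro: E.comp_in simp: amap_comp)
    have "a \<cdot>\<^bsub>E\<^esub> b = Id E Y"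
      using D.cartesian_unique[OF g gD(1), of "a \<cdot>\<^bsub>E\<^esub> b" Y "Id E Y"] ab E.id_in[OF Y] gS
      by (simp add: Hom_full_on amap_id Y E.id_right)
    moreover have "b \<cdot>\<^bsub>E\<^esub> a = Id E Z"
      using t(1) tS(1) ba(1) E.id_in[OF Z]
      by (rule cartesian_unique) (simp_all add: ba ZY amap_id Z E.id_right[OF tS(1)])
    ultimately have "cartesian E B P b" using a b by (blast intro: iso_cartesian)
    with b t tS show "cartesian E B P g" using cartesian_comp by blast
  qed
  ultimately show ?thesis using sub by (simp add: strong_subfibration_def subfibration_def)
qed


section \<open>Locally trivial objects\<close>

lemma loc_b_eq: "loc_b B K Trivb = full_on B (Obj (loc_b B K Trivb))"
  by (simp add: loc_b_def)

lemma loc_t_eq: "loc_t E B P K Trivt = full_on E (Obj (loc_t E B P K Trivt))"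
  by (simp add: loc_t_def)

lemma Obj_loc_b:
  "X \<in> Obj (loc_b B K Trivb) \<longleftrightarrow> X \<in> Obj B \<and> (\<exists>R \<in> K X. \<forall>f \<in> R. Dom B f \<in> Obj Trivb)"
  by (simp add: loc_b_def)

lemma Obj_loc_t:
  "X \<in> Obj (loc_t E B P K Trivt) \<longleftrightarrow> X \<in> Obj E \<and> (\<exists>R \<in> K (omap P X). \<forall>f \<in> R.
     \<exists>t. cartesian E B P t \<and> Cod E t = X \<and> amap P t = f \<and> Dom E t \<in> Obj Trivt)"
  by (simp add: loc_t_def)

lemma trivializing_arrow_dom:
  assumes "subfunctor Trivt Trivb E B P"
    and "t \<in> Arr E" and "Dom E t \<in> Obj Trivt"
  shows "Dom B (amap P t) = omap P (Dom E t)"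
    and "Dom B (amap P t) \<in> Obj Trivb"
proof -
  interpret P: cat_functor E B P using assms(1) by (simp add: subfunctor_def)
  interpret Triv: cat_functor Trivt Trivb P using assms(1) by (simp add: subfunctor_def)
  show eq: "Dom B (amap P t) = omap P (Dom E t)"
    using assms(2) P.amap_in[of t "Dom E t" "Cod E t"] by (simp add: Hom_def)
  show "Dom B (amap P t) \<in> Obj Trivb" unfolding eq using assms(3) by (rule Triv.omap_in)
qed

lemma subfunctor_loc:
  assumes "subfunctor Trivt Trivb E B P"
  shows "subfunctor (loc_t E B P K Trivt) (loc_b B K Trivb) E B P"
proof -
  interpret cat_functor E B P using assms by (simp add: subfunctor_def)
  have "omap P X \<in> Obj (loc_b B K Trivb)" if X: "X \<in> Obj (loc_t E B P K Trivt)" for X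
  proof -
    obtain R where R: "R \<in> K (omap P X)" and triv: "\<forall>f \<in> R.
        \<exists>t. cartesian E B P t \<and> Cod E t = X \<and> amap P t = f \<and> Dom E t \<in> Obj Trivt"
      using X by (auto simp: Obj_loc_t)
    have "Dom B f \<in> Obj Trivb" if "f \<in> R" for f
      using triv that trivializing_arrow_dom(2)[OF assms] by (auto simp: cartesian_def)
    with R X show ?thesis using omap_in by (auto simp: Obj_loc_b Obj_loc_t)
  qed
  then have "subfunctor (full_on E (Obj (loc_t E B P K Trivt)))
      (full_on B (Obj (loc_b B K Trivb))) E B P"
    by (intro subfunctor_full_on cat_functor_axioms) (auto simp: Obj_loc_b Obj_loc_t)
  then show ?thesis by (simp flip: loc_b_eq loc_t_eq)
qed

lemma locally_trivial_iso:
  assumes "cat_functor E B P"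
    and X: "X \<in> Obj (loc_t E B P K Trivt)"
    and v: "v \<in> Hom E X Y" and w: "w \<in> Hom E Y X"
    and wv: "w \<cdot>\<^bsub>E\<^esub> v = Id E X" and vw: "v \<cdot>\<^bsub>E\<^esub> w = Id E Y"
    and vertical: "amap P v = Id B (omap P X)"
  shows "Y \<in> Obj (loc_t E B P K Trivt)"
proof -
  interpret cat_functor E B P by fact
  have Xob: "X \<in> Obj E" and Y: "Y \<in> Obj E"
    using v E.dom_in E.cod_in by (auto simp: Hom_def)
  have PY: "omap P Y = omap P X"
    using amap_in[OF v] vertical B.id_in[OF omap_in[OF Xob]] by (simp add: Hom_def)
  obtain R where R: "R \<in> K (omap P X)" and triv: "\<forall>f \<in> R.
      \<exists>t. cartesian E B P t \<and> Cod E t = X \<and> amap P t = f \<and> Dom E t \<in> Obj Trivt"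
    using X by (auto simp: Obj_loc_t)
  have "\<exists>t. cartesian E B P t \<and> Cod E t = Y \<and> amap P t = f \<and> Dom E t \<in> Obj Trivt"
    if f: "f \<in> R" for f
  proof -
    obtain t where t: "cartesian E B P t" "Cod E t = X" "amap P t = f" "Dom E t \<in> Obj Trivt"
      using triv f by blast
    then have tX: "t \<in> Hom E (Dom E t) X" by (simp add: cartesian_def Hom_def)
    have "cartesian E B P (v \<cdot>\<^bsub>E\<^esub> t)"
      using t(1) tX iso_cartesian[OF v w wv vw] v by (rule cartesian_comp)
    moreover have "amap P (v \<cdot>\<^bsub>E\<^esub> t) = f"
      using t(3) amap_in[OF tX] by (simp add: amap_comp[OF tX v] vertical B.id_left)
    moreover have "v \<cdot>\<^bsub>E\<^esub> t \<in> Hom E (Dom E t) Y" using tX v by (rule E.comp_in)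
    ultimately show ?thesis using t(4) by (auto simp: Hom_def)
  qed
  with R Y PY show ?thesis by (auto simp: Obj_loc_t)
qed

lemma replete_subfunctor_loc:
  assumes "subfunctor Trivt Trivb E B P"
  shows "replete_subfunctor (loc_t E B P K Trivt) (loc_b B K Trivb) E B P"
    (is "replete_subfunctor ?D ?A E B P")
proof -
  interpret cat_functor E B P using assms by (simp add: subfunctor_def)
  have "replete_inclusion (fibre ?D ?A P C) (fibre E B P C)" if "C \<in> Obj ?A" for C
    unfolding replete_inclusion_def
  proof (intro allI impI)
    fix v assume v: "is_iso (fibre E B P C) v \<and> Dom (fibre E B P C) v \<in> Obj (fibre ?D ?A P C)"
    define X Y where "X = Dom E v" and "Y = Cod E v"
    from v obtain w where w: "w \<in> Hom E Y X" "w \<cdot>\<^bsub>E\<^esub> v = Id E X" "v \<cdot>\<^bsub>E\<^esub> w = Id E Y"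
      and v': "v \<in> Hom E X Y" "amap P v = Id B C" and X: "X \<in> Obj ?D" "omap P X = C"
      by (auto simp: is_iso_def fibre_def Hom_def X_def Y_def)
    have Y: "Y \<in> Obj ?D"
      using locally_trivial_iso[OF cat_functor_axioms X(1) v'(1) w] v' X by simp
    have "C \<in> Obj B" using that by (simp add: Obj_loc_b)
    then have "omap P Y = C"
      using amap_in[OF v'(1)] B.id_in[of C] by (simp add: v'(2) Hom_def)
    moreover have "v \<in> Arr ?D"
      using v' X Y by (subst loc_t_eq) (simp add: Hom_def)
    moreover have "Id ?A = Id B" by (simp add: loc_b_def)
    ultimately show "Cod (fibre E B P C) v \<in> Obj (fibre ?D ?A P C) \<and> v \<in> Arr (fibre ?D ?A P C)"
      using Y v' by (simp add: fibre_def Y_def)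
  qed
  with subfunctor_loc[OF assms] show ?thesis by (simp add: replete_subfunctor_def)
qed

lemma globally_full_loc:
  assumes "subfunctor Trivt Trivb E B P"
  shows "globally_full (loc_t E B P K Trivt) (loc_b B K Trivb) E B P"
proof -
  interpret cat_functor E B P using assms by (simp add: subfunctor_def)
  have "full_subcategory (loc_t E B P K Trivt) E" "full_subcategory (loc_b B K Trivb) B"
    unfolding loc_t_def loc_b_def
    by (auto intro: full_subcategory_full_on E.category_axioms B.category_axioms)
  with subfunctor_loc[OF assms] show ?thesis by (simp add: globally_full_def)
qed

text \<open>
  This is where the hypotheses on \<open>Triv\<close> and on \<open>K\<^sub>l\<close> enter: the coverage axiom pulls the
  trivializing covering of \<open>X\<close> back along \<open>P t\<close>, fullness puts the refining arrows into \<open>Triv\<^sub>b\<close>, and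
  the strong fibration \<open>Triv\<close> pulls the trivial objects back along them.
\<close>

lemma cartesian_lift_locally_trivial:
  assumes triv: "strong_subfibration Trivt Trivb E B P"
    and full: "full_subcategory Trivt E" "full_subcategory Trivb B"
    and cov: "coverage (loc_b B K Trivb) (K_loc B K Trivb)"
    and X: "X \<in> Obj (loc_t E B P K Trivt)"
    and t: "cartesian E B P t" "t \<in> Hom E Y X"
    and PY: "omap P Y \<in> Obj (loc_b B K Trivb)"
  shows "Y \<in> Obj (loc_t E B P K Trivt)"
proof -
  let ?A = "loc_b B K Trivb"
  have sub: "subfunctor Trivt Trivb E B P" and fib: "fibration Trivt Trivb P"
    and strong: "\<And>g. cartesian Trivt Trivb P g \<Longrightarrow> cartesian E B P g"
    using triv by (auto simp: strong_subfibration_def subfibration_def)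
  interpret cat_functor E B P using sub by (simp add: subfunctor_def)
  interpret Triv: cat_functor Trivt Trivb P using sub by (simp add: subfunctor_def)
  have A_simps: "Dom ?A = Dom B" "Cod ?A = Cod B" "Comp ?A = Comp B"
    by (simp_all add: loc_b_def)
  define g where "g = amap P t"
  have g: "g \<in> Hom B (omap P Y) (omap P X)" unfolding g_def using t(2) by (rule amap_in)
  have Yob: "Y \<in> Obj E" using t E.dom_in by (auto simp: Hom_def)
  have PX: "omap P X \<in> Obj ?A"
    using subfunctor_loc[OF sub, of K] X by (auto simp: subfunctor_def cat_functor.omap_in)
  have gA: "g \<in> Arr ?A" using g PX PY by (subst loc_b_eq) (simp add: Hom_def)
  obtain R where R: "R \<in> K (omap P X)" and triv_R: "\<forall>f \<in> R.
      \<exists>t. cartesian E B P t \<and> Cod E t = X \<and> amap P t = f \<and> Dom E t \<in> Obj Trivt"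
    using X by (auto simp: Obj_loc_t)
  have "Dom B f \<in> Obj Trivb" if "f \<in> R" for f
    using triv_R that trivializing_arrow_dom(2)[OF sub] by (auto simp: cartesian_def)
  with R have "R \<in> K_loc B K Trivb (omap P X)" by (simp add: K_loc_def)
  then obtain S where S: "S \<in> K_loc B K Trivb (omap P Y)"
    and ref: "refines ?A ((\<lambda>h. g \<cdot>\<^bsub>?A\<^esub> h) ` S) R"
    using cov PX gA g unfolding coverage_def by (fastforce simp: A_simps Hom_def)
  have "\<exists>t. cartesian E B P t \<and> Cod E t = Y \<and> amap P t = s \<and> Dom E t \<in> Obj Trivt"
    if s: "s \<in> S" for s
  proof -
    have "s \<in> Arr ?A \<and> Cod B s = omap P Y"
      using cov s S PY unfolding coverage_def covering_function_def by (auto simp: A_simps)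
    then have sB: "s \<in> Hom B (Dom B s) (omap P Y)"
      by (subst (asm) loc_b_eq) (simp add: Hom_def)
    have s_dom: "Dom B s \<in> Obj Trivb" using s S by (simp add: K_loc_def)
    have gs: "g \<cdot>\<^bsub>B\<^esub> s \<in> Hom B (Dom B s) (omap P X)" using sB g by (rule B.comp_in)
    obtain f k where f: "f \<in> R" and "k \<in> Hom ?A (Dom B (g \<cdot>\<^bsub>B\<^esub> s)) (Dom B f)"
      and eq: "g \<cdot>\<^bsub>B\<^esub> s = f \<cdot>\<^bsub>B\<^esub> k"
      using ref s by (auto simp: refines_def A_simps)
    with gs have k: "k \<in> Hom B (Dom B s) (Dom B f)"
      by (subst (asm) loc_b_eq) (simp add: Hom_def)
    obtain r where r: "cartesian E B P r" "Cod E r = X" "amap P r = f" "Dom E r \<in> Obj Trivt"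
      using triv_R f by blast
    define T where "T = Dom E r"
    have rT: "r \<in> Hom E T X" using r by (simp add: cartesian_def Hom_def T_def)
    have f_dom: "Dom B f = omap P T" "Dom B f \<in> Obj Trivb"
      using trivializing_arrow_dom[OF sub, of r] rT r by (auto simp: Hom_def T_def)
    have kT: "k \<in> Arr Trivb"
      using k s_dom f_dom full(2) by (auto simp: full_subcategory_def Hom_def)
    have "Cod Trivb k = omap P T"
      using k kT f_dom full(2) by (auto simp: full_subcategory_def subcategory_def Hom_def)
    then obtain k' where k': "cartesian Trivt Trivb P k'" "Cod Trivt k' = T" "amap P k' = k"
      using fib kT r(4) unfolding fibration_def T_def by blast
    define W where "W = Dom Trivt k'"
    have "k' \<in> Arr Trivt" using k'(1) by (simp add: cartesian_def)
    then have W: "W \<in> Obj Trivt" and k'E: "k' \<in> Hom E W T"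
      using Triv.E.dom_in k'(2) full(1)
      by (auto simp: W_def full_subcategory_def subcategory_def Hom_def)
    have rk': "cartesian E B P (r \<cdot>\<^bsub>E\<^esub> k')" "r \<cdot>\<^bsub>E\<^esub> k' \<in> Hom E W X"
      using cartesian_comp[OF strong[OF k'(1)] k'E r(1) rT] E.comp_in[OF k'E rT] .
    have PW: "omap P W = Dom B s" using amap_in[OF k'E] k k'(3) by (simp add: Hom_def)
    have "amap P (r \<cdot>\<^bsub>E\<^esub> k') = amap P t \<cdot>\<^bsub>B\<^esub> s"
      using eq by (simp add: amap_comp[OF k'E rT] r(3) k'(3) g_def)
    then obtain q where q: "q \<in> Hom E W Y" "amap P q = s" "t \<cdot>\<^bsub>E\<^esub> q = r \<cdot>\<^bsub>E\<^esub> k'"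
      using cartesian_factor[OF t rk'(2), of s] sB PW by auto
    have "cartesian E B P q" using q(1) t by (rule cartesian_cancel) (simp add: q(3) rk'(1))
    with q W show ?thesis by (auto simp: Hom_def)
  qed
  with S Yob show ?thesis by (auto simp: Obj_loc_t K_loc_def)
qed

theorem proposition3p3p9:
  fixes E Trivt :: "('o, 'a) cat"
    and B Trivb :: "('p, 'b) cat"
    and P :: "('o, 'a, 'p, 'b) fun_data"
    and K :: "'p \<Rightarrow> 'b set set"
  assumes "fibration E B P"
    and "covering_function B K"
    and "isos_cover B K"
    and "replete_subfunctor Trivt Trivb E B P"
    and "globally_full Trivt Trivb E B P"
    and "strong_subfibration Trivt Trivb E B P"
    and "coverage (loc_b B K Trivb) (K_loc B K Trivb)"
  shows "replete_subfunctor (loc_t E B P K Trivt) (loc_b B K Trivb) E B P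
    \<and> globally_full (loc_t E B P K Trivt) (loc_b B K Trivb) E B P
    \<and> strong_subfibration (loc_t E B P K Trivt) (loc_b B K Trivb) E B P"
proof (intro conjI)
  have sub: "subfunctor Trivt Trivb E B P"
    and full: "full_subcategory Trivt E" "full_subcategory Trivb B"
    using assms(5) by (simp_all add: globally_full_def)
  show "replete_subfunctor (loc_t E B P K Trivt) (loc_b B K Trivb) E B P"
    using sub by (rule replete_subfunctor_loc)
  show "globally_full (loc_t E B P K Trivt) (loc_b B K Trivb) E B P"
    using sub by (rule globally_full_loc)
  interpret cat_functor E B P using assms(1) by (simp add: fibration_def)
  let ?S = "Obj (loc_t E B P K Trivt)" and ?T = "Obj (loc_b B K Trivb)"
  have "strong_subfibration (full_on E ?S) (full_on B ?T) E B P"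
  proof (rule strong_subfibration_full_on)
    show "cat_functor E B P" by (rule cat_functor_axioms)
    show "?S \<subseteq> Obj E" "?T \<subseteq> Obj B" by (auto simp: Obj_loc_t Obj_loc_b)
    show "omap P ` ?S \<subseteq> ?T"
      using subfunctor_loc[OF sub, of K] cat_functor.omap_in by (fastforce simp: subfunctor_def)
    fix X f assume X: "X \<in> ?S" and f: "f \<in> Arr B" "Dom B f \<in> ?T" "Cod B f = omap P X"
    have "X \<in> Obj E" using X by (simp add: Obj_loc_t)
    then obtain t where t: "cartesian E B P t" "Cod E t = X" "amap P t = f"
      using assms(1) f unfolding fibration_def by blast
    then have tX: "t \<in> Hom E (Dom E t) X" by (simp add: cartesian_def Hom_def)
    have "omap P (Dom E t) \<in> ?T" using amap_in[OF tX] t(3) f(2) by (simp add: Hom_def)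
    with assms(6) full assms(7) X t(1) tX have "Dom E t \<in> ?S"
      by (rule cartesian_lift_locally_trivial)
    with t show "\<exists>t. cartesian E B P t \<and> Cod E t = X \<and> amap P t = f \<and> Dom E t \<in> ?S" by blast
  qed
  then show "strong_subfibration (loc_t E B P K Trivt) (loc_b B K Trivb) E B P"
    by (simp flip: loc_b_eq loc_t_eq)
qed

end
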